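(* (Maximum principle.) Suppose $T>0$, and $u\in C(\bar U\times[0,T])\cap C^{2,1}_{x,t}(U\times(0,T])$ with $u\ge0$ is a solution of $$\phi u_t=\nabla\cdot\Big(X\big(\nabla u+u^2\mathcal Z(x,t)\big)\Big)$$ on $U\times(0,T]$. Then $$\max_{\bar U\times[0,T]}u=\max_{\partial_p(U\times(0,T])}u.$$
   Context: $N\ge1$ is an integer, $0=\alpha_0<\alpha_1<\dots<\alpha_N$ are real numbers, $a_0,\dots,a_N>0$ are constants, and $g(s)=\sum_{i=0}^N a_is^{\alpha_i}$ for $s\ge0$. $\vec k\in\mathbb R^3$ is a fixed unit vector, $\mathbf J$ is the $3\times3$ matrix with $\mathbf Jx=\vec k\times x$ for all $x\in\mathbb R^3$, and $\mathcal R\ge0$ is a constant. The function $F:\mathbb R^3\to\mathbb R^3$, $F(v)=g(|v|)v+\mathcal R\,\mathbf Jv$, is a $C^1$ bijection whose inverse $X=F^{-1}$ is also $C^1$. $U\subset\mathbb R^3$ is an open bounded set with $C^1$ boundary; $\phi>0$, $\mathcal G>0$, $\Omega\ge0$ are constants, $e_0:\mathbb R\to\mathbb R^3$ is a smooth function with $|e_0(t)|=1$, and $\mathcal Z(x,t)=-\mathcal G e_0(t)+\Omega^2\mathbf J^2x$. The gradient and divergence are in $x$. The parabolic boundary is $\partial_p(U\times(0,T])=(\bar U\times[0,T])\setminus(U\times(0,T])$. $C^{2,1}_{x,t}$ means twice continuously differentiable in $x$ and once in $t$. *)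

theory Defs
  imports "HOL-Analysis.Analysis"
begin

(* The term for \<open>\<alpha> 0 = 0\<close> is written separately as the constant \<open>a 0\<close>, because
   \<open>0 powr 0 = 0\<close> in HOL whereas \<open>s\<^sup>0 = 1\<close> is meant here, also at \<open>s = 0\<close>. *)
definition forch_g :: "nat \<Rightarrow> (nat \<Rightarrow> real) \<Rightarrow> (nat \<Rightarrow> real) \<Rightarrow> real \<Rightarrow> real" where
  "forch_g N \<alpha> a s = a 0 + (\<Sum>i=1..N. a i * s powr \<alpha> i)"

definition forch_F ::
  "nat \<Rightarrow> (nat \<Rightarrow> real) \<Rightarrow> (nat \<Rightarrow> real) \<Rightarrow> real \<Rightarrow> real^3^3 \<Rightarrow> real^3 \<Rightarrow> real^3" where
  "forch_F N \<alpha> a R J v = forch_g N \<alpha> a (norm v) *\<^sub>R v + R *\<^sub>R (J *v v)"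

(* \<open>inv\<close> is the genuine inverse: for \<open>a i > 0\<close>, \<open>\<alpha> i > 0\<close> (\<open>i \<ge> 1\<close>) and antisymmetric \<open>J\<close>, the map
   \<open>forch_F N \<alpha> a R J\<close> is a \<open>C\<^sup>1\<close> bijection with \<open>C\<^sup>1\<close> inverse. *)
definition forch_X ::
  "nat \<Rightarrow> (nat \<Rightarrow> real) \<Rightarrow> (nat \<Rightarrow> real) \<Rightarrow> real \<Rightarrow> real^3^3 \<Rightarrow> real^3 \<Rightarrow> real^3" where
  "forch_X N \<alpha> a R J = inv (forch_F N \<alpha> a R J)"

definition forch_Z ::
  "real \<Rightarrow> (real \<Rightarrow> real^3) \<Rightarrow> real \<Rightarrow> real^3^3 \<Rightarrow> real^3 \<Rightarrow> real \<Rightarrow> real^3" where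
  "forch_Z G e0 \<Omega> J x t = - (G *\<^sub>R e0 t) + \<Omega>\<^sup>2 *\<^sub>R ((J ** J) *v x)"

definition grad :: "(real^'n \<Rightarrow> real) \<Rightarrow> real^'n \<Rightarrow> real^'n" where
  "grad f x = (\<chi> i. frechet_derivative f (at x) (axis i 1))"

definition divergence :: "(real^'n \<Rightarrow> real^'n) \<Rightarrow> real^'n \<Rightarrow> real" where
  "divergence V x = (\<Sum>i\<in>UNIV. frechet_derivative V (at x) (axis i 1) $ i)"

definition smooth_curve :: "(real \<Rightarrow> 'a::real_normed_vector) \<Rightarrow> bool" where
  "smooth_curve f \<longleftrightarrow>
    (\<exists>D. D 0 = f \<and> (\<forall>n t. (D n has_vector_derivative D (Suc n) t) (at t)))"

(* Near each boundary point \<open>U\<close> is, in suitable Cartesian coordinates (given by \<open>Q\<close>), the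
   region strictly above the graph of a \<open>C\<^sup>1\<close> function of the first two coordinates.  The
   translation to the boundary point is absorbed into \<open>\<gamma>\<close>. *)
definition C1_boundary :: "(real^3) set \<Rightarrow> bool" where
  "C1_boundary U \<longleftrightarrow>
    (\<forall>p\<in>frontier U. \<exists>r>0. \<exists>Q::real^3 \<Rightarrow> real^3. \<exists>\<gamma>::real^2 \<Rightarrow> real. \<exists>D\<gamma>.
       orthogonal_transformation Q \<and>
       (\<forall>y. GDERIV \<gamma> y :> D\<gamma> y) \<and> continuous_on UNIV D\<gamma> \<and>
       U \<inter> ball p r = {x \<in> ball p r. \<gamma> (vector [Q x $ 1, Q x $ 2]) < Q x $ 3})"

(* The time derivative is taken within \<open>I\<close>: for \<open>I = {0<..T}\<close> it is the left derivative
   at \<open>t = T\<close>.  Continuity is joint in space and time. *)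
definition C21_on ::
  "(real^'n) set \<Rightarrow> real set \<Rightarrow> (real^'n \<Rightarrow> real \<Rightarrow> real) \<Rightarrow> bool" where
  "C21_on U I u \<longleftrightarrow>
    (\<exists>(Du :: real^'n \<Rightarrow> real \<Rightarrow> real^'n) (D2u :: real^'n \<Rightarrow> real \<Rightarrow> real^'n^'n)
      (Dtu :: real^'n \<Rightarrow> real \<Rightarrow> real).
       (\<forall>x\<in>U. \<forall>t\<in>I.
          (GDERIV (\<lambda>y. u y t) x :> Du x t) \<and>
          ((\<lambda>y. Du y t) has_derivative (\<lambda>h. D2u x t *v h)) (at x) \<and>
          ((\<lambda>s. u x s) has_vector_derivative Dtu x t) (at t within I)) \<and>
       continuous_on (U \<times> I) (\<lambda>(x, t). u x t) \<and>
       continuous_on (U \<times> I) (\<lambda>(x, t). Du x t) \<and>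
       continuous_on (U \<times> I) (\<lambda>(x, t). D2u x t) \<and>
       continuous_on (U \<times> I) (\<lambda>(x, t). Dtu x t))"

definition parabolic_boundary :: "'a::topological_space set \<Rightarrow> real \<Rightarrow> ('a \<times> real) set" where
  "parabolic_boundary U T = (closure U \<times> {0..T}) - (U \<times> {0<..T})"

definition is_max_on :: "('a \<Rightarrow> real) \<Rightarrow> 'a set \<Rightarrow> real \<Rightarrow> bool" where
  "is_max_on f S M \<longleftrightarrow> (\<exists>z\<in>S. f z = M) \<and> (\<forall>z\<in>S. f z \<le> M)"

end

theory Submission
  imports Defs
begin

text \<open>At an interior maximum of \<open>u - \<epsilon> t\<close> the gradient of \<open>u\<close> vanishes, so the divergence reduces to
  the trace of \<open>DX (D\<^sup>2u + u\<^sup>2 \<Omega>\<^sup>2 J\<^sup>2)\<close>. Strong monotonicity of \<open>F\<close> makes the quadratic form of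
  \<open>DX\<close> nonnegative, while \<open>D\<^sup>2u\<close> and \<open>J\<^sup>2\<close> are symmetric and negative semidefinite; hence the trace is
  nonpositive, contradicting \<open>u\<^sub>t \<ge> \<epsilon> > 0\<close>. Symmetry of \<open>D\<^sup>2u\<close> is essential because \<open>DX\<close> is not
  symmetric when \<open>R > 0\<close>.\<close>

section \<open>Strongly monotone maps and their inverses\<close>

text \<open>Cauchy-Schwarz, then cancellation of one factor \<open>norm (v - w)\<close>. The
  resulting expansion bound yields injectivity and a Lipschitz inverse.\<close>

lemma strongly_monotone_norm_le:
  fixes F :: "'a::real_inner \<Rightarrow> 'a"
  assumes "\<And>v w. c * (norm (v - w))\<^sup>2 \<le> (F v - F w) \<bullet> (v - w)"
  shows "c * norm (v - w) \<le> norm (F v - F w)"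
proof (cases "v = w")
  case False
  have "(c * norm (v - w)) * norm (v - w) \<le> norm (F v - F w) * norm (v - w)"
    using assms[of v w] norm_cauchy_schwarz[of "F v - F w" "v - w"] by (simp add: power2_eq_square mult.assoc)
  then show ?thesis using False by simp
qed simp

text \<open>The range is open by invariance of domain and closed because the expansion bound pulls
  Cauchy sequences back; connectedness of the space then gives surjectivity. Bijectivity is what
  makes \<open>inv F\<close> a two-sided inverse.\<close>

lemma strongly_monotone_bij:
  fixes F :: "'a::euclidean_space \<Rightarrow> 'a"
  assumes c: "c > 0" and cont: "continuous_on UNIV F"
    and mono: "\<And>v w. c * (norm (v - w))\<^sup>2 \<le> (F v - F w) \<bullet> (v - w)"
  shows "bij F"
proof -
  note le = strongly_monotone_norm_le[of c F, OF mono]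
  have inj: "inj F"
  proof (rule injI)
    fix v w assume "F v = F w"
    then have "c * norm (v - w) \<le> 0" using le[of v w] by simp
    then show "v = w" using c by (simp add: mult_le_0_iff)
  qed
  have op: "open (range F)"
    using invariance_of_domain[OF cont open_UNIV inj] .
  have "closed (range F)"
    unfolding closed_sequential_limits
  proof (intro allI impI, elim conjE)
    fix y l assume y: "\<forall>n. y n \<in> range F" and lim: "y \<longlonglongrightarrow> l"
    from y have "\<forall>n. \<exists>x. y n = F x" by blast
    then obtain x where x: "\<And>n. y n = F (x n)" using choice[of "\<lambda>n x. y n = F x"] by blast
    \<comment> \<open>Images closer than \<open>c * e\<close> force preimages closer than
      \<open>e\<close>.\<close>
    have "Cauchy x"
    proof (rule metric_CauchyI)
      fix e :: real assume e: "e > 0"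
      have "Cauchy y" using lim LIMSEQ_imp_Cauchy by blast
      then obtain M where M: "\<And>m n. m \<ge> M \<Longrightarrow> n \<ge> M \<Longrightarrow> dist (y m) (y n) < c * e"
        using metric_CauchyD[of y "c * e"] c e by auto
      have "dist (x m) (x n) < e" if "m \<ge> M" "n \<ge> M" for m n
      proof -
        have "c * dist (x m) (x n) < c * e"
          using M[OF that] le[of "x m" "x n"] by (simp add: x dist_norm)
        then show ?thesis using c by simp
      qed
      then show "\<exists>M. \<forall>m\<ge>M. \<forall>n\<ge>M. dist (x m) (x n) < e" by blast
    qed
    then obtain z where z: "x \<longlonglongrightarrow> z" using Cauchy_convergent convergent_def by blast
    have "isCont F z" using cont by (simp add: continuous_on_eq_continuous_at)
    then have "(\<lambda>n. F (x n)) \<longlonglongrightarrow> F z" using z isCont_tendsto_compose by blast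
    then have "y \<longlonglongrightarrow> F z" by (simp add: x[abs_def])
    then have "l = F z" using lim LIMSEQ_unique by blast
    then show "l \<in> range F" by simp
  qed
  then have "range F = UNIV" using op clopen[of "range F"] by auto
  then show ?thesis using inj by (simp add: bij_def)
qed

lemma strongly_monotone_derivative:
  fixes F :: "'a::real_inner \<Rightarrow> 'a"
  assumes mono: "\<And>v w. c * (norm (v - w))\<^sup>2 \<le> (F v - F w) \<bullet> (v - w)"
    and D: "(F has_derivative F') (at x)"
  shows "c * (norm h)\<^sup>2 \<le> F' h \<bullet> h"
proof (rule ccontr)
  assume neg: "\<not> ?thesis"
  \<comment> \<open>If the claim failed, \<open>f\<close> would have negative slope at 0 and drop
    just to the right of it, whereas strong monotonicity between \<open>x + s *\<^sub>R h\<close>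
    and \<open>x\<close> says \<open>f 0 \<le> f s\<close> for \<open>s > 0\<close>.\<close>
  define f where "f s = F (x + s *\<^sub>R h) \<bullet> h - c * s * (norm h)\<^sup>2" for s :: real
  interpret F': bounded_linear F' using D has_derivative_bounded_linear by blast
  have D': "(F has_derivative F') (at (x + 0 *\<^sub>R h))" using D by simp
  have "((\<lambda>s. F (x + s *\<^sub>R h)) has_derivative (\<lambda>s. F' (s *\<^sub>R h))) (at 0)"
    by (rule has_derivative_compose[of "\<lambda>s. x + s *\<^sub>R h", OF _ D'])
      (auto intro!: derivative_eq_intros)
  then have "(f has_derivative (\<lambda>s. F' (s *\<^sub>R h) \<bullet> h - c * s * (norm h)\<^sup>2)) (at 0)"
    unfolding f_def by (auto intro!: derivative_eq_intros)
  then have "DERIV f 0 :> F' h \<bullet> h - c * (norm h)\<^sup>2"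
    by (simp add: has_field_derivative_def F'.scaleR algebra_simps)
       (erule has_derivative_eq_rhs, simp add: fun_eq_iff algebra_simps)
  moreover have "F' h \<bullet> h - c * (norm h)\<^sup>2 < 0" using neg by simp
  ultimately obtain d where d: "d > 0" "\<And>s. 0 < s \<Longrightarrow> s < d \<Longrightarrow> f (0 + s) < f 0"
    using DERIV_neg_dec_right[of f] by blast
  define s where "s = d / 2"
  have s: "0 < s" "s < d" using d by (auto simp: s_def)
  have "c * (norm (s *\<^sub>R h))\<^sup>2 \<le> (F (x + s *\<^sub>R h) - F x) \<bullet> (s *\<^sub>R h)"
    using mono[of "x + s *\<^sub>R h" x] by simp
  then have "s * (c * s * (norm h)\<^sup>2) \<le> s * ((F (x + s *\<^sub>R h) - F x) \<bullet> h)"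
    using s by (simp add: power2_eq_square algebra_simps)
  then have "f 0 \<le> f s" using s by (simp add: f_def inner_diff_left)
  then show False using d(2)[OF s] by simp
qed

text \<open>The derivative \<open>F'\<close> inherits coercivity, so it is injective and hence
  invertible in finite dimension; \<open>X'\<close> is its inverse. Testing coercivity of
  \<open>F'\<close> at \<open>X' h\<close> gives the sign of the quadratic form of
  \<open>X'\<close>.\<close>

lemma strongly_monotone_inverse_derivative:
  fixes F :: "'a::euclidean_space \<Rightarrow> 'a"
  assumes c: "c > 0" and diff: "\<And>x. F differentiable (at x)"
    and mono: "\<And>v w. c * (norm (v - w))\<^sup>2 \<le> (F v - F w) \<bullet> (v - w)"
  obtains X' where "(inv F has_derivative X') (at y)" "\<And>h. 0 \<le> X' h \<bullet> h"
proof -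
  have "continuous_on UNIV F"
    using diff by (intro differentiable_imp_continuous_on) (simp add: differentiable_on_def)
  then have bij: "bij F" using strongly_monotone_bij[OF c _ mono] by blast
  then have FX: "F (inv F z) = z" for z by (simp add: bij_is_surj surj_f_inv_f)
  obtain F' where F': "(F has_derivative F') (at (inv F y))"
    using diff unfolding differentiable_def by blast
  have pos: "c * (norm h)\<^sup>2 \<le> F' h \<bullet> h" for h
    using strongly_monotone_derivative[OF mono F'] .
  have lin: "linear F'" using F' has_derivative_linear by blast
  have "inj F'"
  proof -
    have "h = 0" if "F' h = 0" for h
      using pos[of h] c that by (simp add: mult_le_0_iff)
    then show ?thesis using lin linear_injective_0 by blast
  qed
  then obtain X' where X': "linear X'" "\<And>h. X' (F' h) = h" "\<And>h. F' (X' h) = h"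
    using linear_injective_isomorphism[OF lin] by blast
  have lip: "norm (inv F z - inv F y) \<le> norm (z - y) / c" for z
    using strongly_monotone_norm_le[of c F "inv F z" "inv F y", OF mono] c
    by (simp add: FX field_simps)
  \<comment> \<open>Continuity of the inverse at \<open>y\<close>, required by the inverse
    derivative rule, comes from its Lipschitz bound.\<close>
  have "(inv F \<longlongrightarrow> inv F y) (at y)"
  proof (rule LIM_zero_cancel, rule Lim_null_comparison)
    show "\<forall>\<^sub>F z in at y. norm (inv F z - inv F y) \<le> norm (z - y) / c"
      using lip by simp
    have "((\<lambda>z. norm (z - y) / c) \<longlongrightarrow> norm (y - y) / c) (at y)"
      using c by (intro tendsto_intros) auto
    then show "((\<lambda>z. norm (z - y) / c) \<longlongrightarrow> 0) (at y)" by simp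
  qed
  then have cont: "isCont (inv F) y" by (simp add: continuous_at)
  have "(inv F has_derivative X') (at y)"
  proof (rule has_derivative_inverse_basic[where T = UNIV])
    show "(F has_derivative F') (at (inv F y))" by (rule F')
    show "bounded_linear X'" using X'(1) by (simp add: linear_conv_bounded_linear)
    show "X' \<circ> F' = id" using X'(2) by (simp add: fun_eq_iff)
  qed (use FX cont in auto)
  moreover have "0 \<le> X' h \<bullet> h" for h
  proof -
    have "0 \<le> c * (norm (X' h))\<^sup>2" using c by simp
    then show ?thesis using pos[of "X' h"] X'(3)[of h] by (simp add: inner_commute)
  qed
  ultimately show ?thesis using that by blast
qed

section \<open>The Forchheimer map: differentiability and strong monotonicity\<close>

text \<open>By Cauchy-Schwarz the inner product is at least its value for parallel vectors with the
  same norms, and that value is nonnegative because \<open>s powr b * s\<close> is nondecreasing for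
  \<open>s \<ge> 0\<close>.\<close>

lemma powr_norm_scaleR_monotone:
  fixes v w :: "'a::real_inner"
  assumes "b \<ge> 0"
  shows "0 \<le> (norm v powr b *\<^sub>R v - norm w powr b *\<^sub>R w) \<bullet> (v - w)"
proof -
  define p q where "p = norm v powr b" and "q = norm w powr b"
  have pq: "p \<ge> 0" "q \<ge> 0" by (simp_all add: p_def q_def)
  have "0 \<le> (p * norm v - q * norm w) * (norm v - norm w)"
  proof (cases "norm v \<le> norm w")
    case True
    then have "p * norm v \<le> q * norm w"
      unfolding p_def q_def using assms by (intro mult_mono powr_mono2) auto
    then show ?thesis using True by (simp add: mult_nonpos_nonpos)
  next
    case False
    then have "q * norm w \<le> p * norm v"
      unfolding p_def q_def using assms by (intro mult_mono powr_mono2) auto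
    then show ?thesis using False by simp
  qed
  also have "\<dots> = p * (norm v)\<^sup>2 + q * (norm w)\<^sup>2 - (p + q) * (norm v * norm w)"
    by (simp add: power2_eq_square algebra_simps)
  also have "\<dots> \<le> p * (norm v)\<^sup>2 + q * (norm w)\<^sup>2 - (p + q) * (v \<bullet> w)"
    using pq by (intro diff_left_mono mult_left_mono norm_cauchy_schwarz) auto
  also have "\<dots> = (p *\<^sub>R v - q *\<^sub>R w) \<bullet> (v - w)"
    by (simp add: power2_norm_eq_inner inner_diff_left inner_diff_right inner_commute algebra_simps)
  finally show ?thesis unfolding p_def q_def .
qed

text \<open>Away from the origin this is a product of differentiable maps. At the origin, where
  \<open>norm\<close> itself has no derivative, the map is o(|h|) and its derivative is 0.\<close>

lemma powr_norm_scaleR_differentiable: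
  fixes x :: "'a::real_inner"
  assumes "b > 0"
  shows "(\<lambda>v. norm v powr b *\<^sub>R v) differentiable (at x)"
proof (cases "x = 0")
  case True
  have "((\<lambda>v::'a. norm v powr b *\<^sub>R v) has_derivative (\<lambda>_. 0)) (at 0)"
    unfolding has_derivative_at
  proof (intro conjI)
    \<comment> \<open>Division of the remainder by \<open>norm h\<close> leaves exactly
      \<open>norm h powr b\<close>, which vanishes in the limit because
      \<open>b > 0\<close>.\<close>
    have "((\<lambda>h::'a. norm h powr b) \<longlongrightarrow> 0 powr b) (at 0)"
      using assms by (intro tendsto_powr2 tendsto_intros tendsto_norm_zero) auto
    then have "((\<lambda>h::'a. norm h powr b) \<longlongrightarrow> 0) (at 0)" using assms by simp
    then show "((\<lambda>h::'a. norm (norm (0 + h) powr b *\<^sub>R (0 + h) - norm (0::'a) powr b *\<^sub>R 0 - 0) / norm h) \<longlongrightarrow> 0) (at 0)"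
      by (rule Lim_transform_eventually) (auto simp: eventually_at_filter)
  qed simp
  then show ?thesis unfolding differentiable_def True by blast
next
  case False
  have n: "(norm has_derivative (\<lambda>h. h \<bullet> sgn x)) (at x)"
    using has_derivative_norm[OF False] .
  have "((\<lambda>v. norm v powr b) has_derivative (\<lambda>h. norm x powr b * (0 * ln (norm x) + (h \<bullet> sgn x) * b / norm x))) (at x)"
    using False by (intro has_derivative_powr n) auto
  then have "(\<lambda>v. norm v powr b) differentiable (at x)" unfolding differentiable_def by blast
  then show ?thesis by (intro differentiable_scaleR) auto
qed

lemma forch_F_eq:
  "forch_F N \<alpha> a R J v =
    a 0 *\<^sub>R v + (\<Sum>i=1..N. a i *\<^sub>R (norm v powr \<alpha> i *\<^sub>R v)) + R *\<^sub>R (J *v v)"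
  by (simp add: forch_F_def forch_g_def scaleR_add_left scaleR_sum_left)

lemma forch_F_differentiable:
  assumes "\<And>i. 1 \<le> i \<Longrightarrow> i \<le> N \<Longrightarrow> \<alpha> i > 0"
  shows "forch_F N \<alpha> a R J differentiable (at x)"
proof -
  have J: "(\<lambda>v. J *v v) differentiable (at x)"
    using bounded_linear_imp_differentiable matrix_vector_mul_bounded_linear by blast
  have "(\<lambda>v. a 0 *\<^sub>R v + (\<Sum>i=1..N. a i *\<^sub>R (norm v powr \<alpha> i *\<^sub>R v)) + R *\<^sub>R (J *v v)) differentiable (at x)"
    using assms J
    by (intro differentiable_add differentiable_scaleR differentiable_sum ballI
        powr_norm_scaleR_differentiable differentiable_const differentiable_ident) auto
  then show ?thesis unfolding forch_F_eq[abs_def] .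
qed

text \<open>The constant term of \<open>forch_g\<close> supplies the modulus \<open>a 0\<close>,
  each power term is monotone, and the rotation term is orthogonal to \<open>v - w\<close>.\<close>

lemma forch_F_strongly_monotone:
  assumes "\<And>i. 1 \<le> i \<Longrightarrow> i \<le> N \<Longrightarrow> \<alpha> i > 0" and "\<And>i. i \<le> N \<Longrightarrow> a i > 0"
    and J: "\<And>x. (J *v x) \<bullet> x = 0"
  shows "a 0 * (norm (v - w))\<^sup>2 \<le> (forch_F N \<alpha> a R J v - forch_F N \<alpha> a R J w) \<bullet> (v - w)"
proof -
  have "forch_F N \<alpha> a R J v - forch_F N \<alpha> a R J w = a 0 *\<^sub>R (v - w) +
     (\<Sum>i=1..N. a i *\<^sub>R (norm v powr \<alpha> i *\<^sub>R v - norm w powr \<alpha> i *\<^sub>R w)) + R *\<^sub>R (J *v (v - w))"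
    unfolding forch_F_eq by (simp add: scaleR_diff_right sum_subtractf matrix_vector_mult_diff_distrib)
  then have "(forch_F N \<alpha> a R J v - forch_F N \<alpha> a R J w) \<bullet> (v - w) = a 0 * (norm (v - w))\<^sup>2 +
     (\<Sum>i=1..N. a i * ((norm v powr \<alpha> i *\<^sub>R v - norm w powr \<alpha> i *\<^sub>R w) \<bullet> (v - w)))"
    by (simp add: inner_add_left inner_sum_left J power2_norm_eq_inner)
  moreover have "0 \<le> (\<Sum>i=1..N. a i * ((norm v powr \<alpha> i *\<^sub>R v - norm w powr \<alpha> i *\<^sub>R w) \<bullet> (v - w)))"
    using assms by (intro sum_nonneg mult_nonneg_nonneg powr_norm_scaleR_monotone) (auto simp: less_imp_le)
  ultimately show ?thesis by simp
qed

section \<open>A trace inequality for a possibly nonsymmetric factor\<close>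

text \<open>Eliminates one row of \<open>P\<close> at a time by a Schur complement, which exhibits \<open>P\<close> as a sum of rank-one matrices.\<close>
lemma trace_matrix_mult_nonneg_supported:
  fixes A P :: "real^'n^'n"
  assumes "finite I"
    and "\<And>i j. i \<notin> I \<Longrightarrow> P $ i $ j = 0"
    and "\<And>h. 0 \<le> (A *v h) \<bullet> h" and "transpose P = P" and "\<And>h. 0 \<le> (P *v h) \<bullet> h"
  shows "0 \<le> trace (A ** P)"
  using assms
proof (induction I arbitrary: P rule: finite_induct)
  case empty
  then show ?case by (simp add: trace_def matrix_matrix_mult_def)
next
  case (insert k I)
  define p where "p = P $ k"
  have sym: "P $ i $ j = P $ j $ i" for i j
    using insert.prems(3) by (metis transpose_def vec_lambda_beta)
  have Pp: "P *v axis k 1 = p"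
    by (simp add: vec_eq_iff p_def matrix_vector_mult_basis column_def sym)
  have Pk: "(P *v x) \<bullet> axis k 1 = p \<bullet> x" for x
    by (simp add: inner_axis p_def matrix_vector_mul_component)
  then have Pk': "(P *v x) $ k = p \<bullet> x" for x by (simp add: inner_axis)
  \<comment> \<open>The form of \<open>P\<close> evaluated at \<open>x\<close> shifted by
    \<open>c\<close> times the \<open>k\<close>-th basis vector; varying \<open>c\<close> gives all
    the information needed on row \<open>k\<close>.\<close>
  have quad: "0 \<le> (P *v x) \<bullet> x + 2 * c * (p \<bullet> x) + c\<^sup>2 * p $ k" for x c
  proof -
    have "0 \<le> (P *v (x + c *\<^sub>R axis k 1)) \<bullet> (x + c *\<^sub>R axis k 1)" using insert.prems(4) .
    also have "\<dots> = (P *v x) \<bullet> x + 2 * c * (p \<bullet> x) + c\<^sup>2 * p $ k"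
      by (simp add: matrix_vector_right_distrib matrix_vector_mult_scaleR Pp Pk Pk' inner_add_left
          inner_add_right inner_axis power2_eq_square algebra_simps)
    finally show ?thesis .
  qed
  have pk0: "0 \<le> p $ k" using quad[of 0 1] by simp
  show ?case
  proof (cases "p $ k = 0")
    case True
    \<comment> \<open>With a zero pivot, \<open>quad\<close> is affine in \<open>c\<close>, so a
      nonzero slope would let it become negative.\<close>
    have "p \<bullet> x = 0" for x
    proof (rule ccontr)
      assume nz: "p \<bullet> x \<noteq> 0"
      have "0 \<le> (P *v x) \<bullet> x + 2 * (- (((P *v x) \<bullet> x + 1) / (p \<bullet> x))) * (p \<bullet> x)"
        using quad[of x "- (((P *v x) \<bullet> x + 1) / (p \<bullet> x))"] True by simp
      also have "\<dots> = - ((P *v x) \<bullet> x) - 2" using nz by simp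
      finally show False using insert.prems(4)[of x] by simp
    qed
    then have "p = 0" using inner_eq_zero_iff by blast
    then have "P $ i $ j = 0" if "i \<notin> I" for i j
      using insert.prems(1)[of i j] that by (cases "i = k") (auto simp: p_def)
    then show ?thesis using insert.IH[of P] insert.prems by blast
  next
    case False
    then have pk: "p $ k > 0" using pk0 by simp
    \<comment> \<open>The rank-one matrix that agrees with \<open>P\<close> in row and column
      \<open>k\<close>; \<open>P - V\<close> is the Schur complement, supported on
      \<open>I\<close>.\<close>
    define V where "V = (\<chi> i j. p $ i * p $ j / p $ k)"
    have V: "V *v x = ((p \<bullet> x) / p $ k) *\<^sub>R p" for x
      by (simp add: vec_eq_iff V_def matrix_vector_mult_def inner_vec_def sum_distrib_left
          sum_divide_distrib sum_distrib_right mult_ac)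
    have "0 \<le> trace (A ** (P - V))"
    proof (rule insert.IH)
      fix i j assume i: "i \<notin> I"
      show "(P - V) $ i $ j = 0"
      proof (cases "i = k")
        case True
        then show ?thesis using pk by (simp add: V_def p_def)
      next
        case False
        then have "P $ i $ j = 0" for j using insert.prems(1) i by blast
        moreover have "p $ i = 0" using calculation[of k] sym[of i k] by (simp add: p_def)
        ultimately show ?thesis by (simp add: V_def)
      qed
    next
      fix h
      \<comment> \<open>This \<open>c\<close> minimises \<open>quad\<close>, and the minimum is the
        form of \<open>P - V\<close>.\<close>
      have "0 \<le> (P *v h) \<bullet> h + 2 * (- ((p \<bullet> h) / p $ k)) * (p \<bullet> h) + (- ((p \<bullet> h) / p $ k))\<^sup>2 * p $ k"
        by (rule quad)
      also have "\<dots> = ((P - V) *v h) \<bullet> h"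
        using pk by (simp add: matrix_vector_mult_diff_rdistrib V inner_diff_left power2_eq_square field_simps)
      finally show "0 \<le> ((P - V) *v h) \<bullet> h" .
    next
      show "transpose (P - V) = P - V"
        by (simp add: vec_eq_iff transpose_def V_def sym mult.commute)
    qed (rule insert.prems(2))
    \<comment> \<open>Against a rank-one matrix the trace is the quadratic form of \<open>A\<close>
      at \<open>p\<close>, divided by the positive pivot.\<close>
    moreover have "trace (A ** V) = (A *v p) \<bullet> p / p $ k"
      by (simp add: trace_def matrix_matrix_mult_def V_def inner_vec_def matrix_vector_mult_def
          sum_distrib_left sum_divide_distrib sum_distrib_right mult_ac)
    moreover have "trace (A ** P) = trace (A ** (P - V)) + trace (A ** V)"
      by (simp add: trace_add[symmetric] matrix_add_ldistrib[symmetric])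
    ultimately show ?thesis using pk insert.prems(2)[of p] by simp
  qed
qed

text \<open>The previous inequality for \<open>- M\<close>, with all rows allowed as support.
  Against a symmetric \<open>M\<close> only the symmetric part of \<open>A\<close> contributes, so a
  sign of its quadratic form suffices.\<close>

lemma trace_matrix_mult_nonpos:
  fixes A M :: "real^'n^'n"
  assumes "\<And>h. 0 \<le> (A *v h) \<bullet> h" "transpose M = M" "\<And>h. (M *v h) \<bullet> h \<le> 0"
  shows "trace (A ** M) \<le> 0"
proof -
  have neg: "(- M) *v h = - (M *v h)" for h
    by (simp add: vec_eq_iff matrix_vector_mult_def sum_negf)
  have "0 \<le> trace (A ** (- M))"
    using assms by (intro trace_matrix_mult_nonneg_supported[of UNIV]) (auto simp: neg transpose_def vec_eq_iff)
  moreover have "trace (A ** (- M)) = - trace (A ** M)"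
    by (simp add: trace_def matrix_matrix_mult_def sum_negf)
  ultimately show ?thesis by simp
qed

section \<open>Second-order calculus: symmetry of the Hessian and the maximum test\<close>

lemma has_real_derivative_along_line:
  fixes f :: "'a::real_inner \<Rightarrow> real"
  assumes "GDERIV f (x + s *\<^sub>R h) :> D"
  shows "((\<lambda>s. f (x + s *\<^sub>R h)) has_real_derivative (h \<bullet> D)) (at s)"
proof -
  have "((\<lambda>s. f (x + s *\<^sub>R h)) has_derivative (\<lambda>s. (s *\<^sub>R h) \<bullet> D)) (at s)"
    by (rule has_derivative_compose[of "\<lambda>s. x + s *\<^sub>R h" _ _ _ f "\<lambda>h. h \<bullet> D"])
      (use assms in \<open>auto simp: gderiv_def intro!: derivative_eq_intros\<close>)
  then show ?thesis by (simp add: has_field_derivative_def mult.commute[of "h \<bullet> D"] mult_commute_abs)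
qed

text \<open>The mixed second difference is the increment over \<open>[0, s]\<close> of the
  difference of \<open>f\<close> along two parallel segments in direction \<open>h\<close>, so a
  single mean value theorem applies. The bound on \<open>s\<close> keeps both segments in the
  ball.\<close>

lemma second_difference_mvt:
  fixes f :: "'a::real_inner \<Rightarrow> real"
  assumes G: "\<And>y. y \<in> ball x r \<Longrightarrow> GDERIV f y :> Df y"
    and s: "s > 0" "s * (norm h + norm k) < r"
  obtains z where "0 < z" "z < s"
    "f (x + s *\<^sub>R h + s *\<^sub>R k) - f (x + s *\<^sub>R h) - f (x + s *\<^sub>R k) + f x
      = s * (h \<bullet> (Df (x + s *\<^sub>R k + z *\<^sub>R h) - Df (x + z *\<^sub>R h)))"
proof -
  define g where "g z = f ((x + s *\<^sub>R k) + z *\<^sub>R h) - f (x + z *\<^sub>R h)" for z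
  have D: "(g has_real_derivative (h \<bullet> (Df (x + s *\<^sub>R k + z *\<^sub>R h) - Df (x + z *\<^sub>R h)))) (at z)"
    if z: "0 \<le> z" "z \<le> s" for z
  proof -
    have zh: "norm (z *\<^sub>R h) \<le> s * norm h" using z by (simp add: mult_right_mono)
    have sk: "norm (s *\<^sub>R k) = s * norm k" using s by simp
    have "0 \<le> s * norm k" using s by simp
    then have "norm (z *\<^sub>R h) < r" "norm (s *\<^sub>R k + z *\<^sub>R h) < r"
      using zh sk s norm_triangle_ineq[of "s *\<^sub>R k" "z *\<^sub>R h"]
      unfolding distrib_left by linarith+
    then have "x + z *\<^sub>R h \<in> ball x r" "(x + s *\<^sub>R k) + z *\<^sub>R h \<in> ball x r"
      by (simp_all add: dist_norm norm_minus_commute add.assoc)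
         (metis add.commute minus_add_distrib norm_minus_cancel)
    then show ?thesis
      unfolding g_def inner_diff_right by (intro DERIV_diff has_real_derivative_along_line G)
  qed
  obtain z where z: "0 < z" "z < s"
    "g s - g 0 = (s - 0) * (h \<bullet> (Df (x + s *\<^sub>R k + z *\<^sub>R h) - Df (x + z *\<^sub>R h)))"
    using MVT2[OF s(1) D] by blast
  from z(3) have "f (x + s *\<^sub>R h + s *\<^sub>R k) - f (x + s *\<^sub>R h) - f (x + s *\<^sub>R k) + f x
      = s * (h \<bullet> (Df (x + s *\<^sub>R k + z *\<^sub>R h) - Df (x + z *\<^sub>R h)))"
    by (simp add: g_def add_ac)
  with z(1,2) show ?thesis by (rule that)
qed

text \<open>Both gradients produced by the mean value theorem are expanded to first order at
  \<open>x\<close>; their difference is \<open>s *\<^sub>R L k\<close> up to a small multiple of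
  \<open>s\<close>.\<close>

lemma second_difference_bound:
  fixes f :: "'a::real_inner \<Rightarrow> real"
  assumes G: "\<And>y. y \<in> ball x r \<Longrightarrow> GDERIV f y :> Df y" and r: "r > 0"
    and D: "(Df has_derivative L) (at x)" and e: "e > 0"
  shows "\<forall>\<^sub>F s in at_right 0.
    \<bar>f (x + s *\<^sub>R h + s *\<^sub>R k) - f (x + s *\<^sub>R h) - f (x + s *\<^sub>R k) + f x - s\<^sup>2 * (h \<bullet> L k)\<bar> \<le> e * s\<^sup>2"
proof -
  interpret L: bounded_linear L using D has_derivative_bounded_linear by blast
  define C where "C = norm h + norm k + 1"
  have C: "C > 0" by (simp add: C_def add_nonneg_pos)
  \<comment> \<open>Two remainders of size \<open>e' * (s * C)\<close>, multiplied by
    \<open>s\<close> and by \<open>norm h \<le> C\<close>, add up to exactly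
    \<open>e * s\<^sup>2\<close>. The summand 1 in \<open>C\<close> keeps it positive even when
    \<open>h\<close> and \<open>k\<close> vanish.\<close>
  define e' where "e' = e / (2 * C * C)"
  have e': "e' > 0" using e C by (simp add: e'_def)
  obtain d where d: "d > 0"
    and dD: "\<And>y. norm (y - x) < d \<Longrightarrow> norm (Df y - Df x - L (y - x)) \<le> e' * norm (y - x)"
    using D e' unfolding has_derivative_at_alt by blast
  define m where "m = min r d / C"
  have m: "m > 0" using r d C by (simp add: m_def)
  show ?thesis
    unfolding eventually_at_right_field
  proof (intro exI conjI allI impI)
    show "0 < m" by fact
    fix s :: real assume s: "0 < s" "s < m"
    have sC: "s * C < r" "s * C < d" using s C by (auto simp: m_def pos_less_divide_eq)
    have "s * (norm h + norm k) \<le> s * C" using s by (simp add: C_def)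
    then have "s * (norm h + norm k) < r" using sC by simp
    from second_difference_mvt[of x r f Df, OF G s(1) this] obtain z where z: "0 < z" "z < s"
      and eq: "f (x + s *\<^sub>R h + s *\<^sub>R k) - f (x + s *\<^sub>R h) - f (x + s *\<^sub>R k) + f x
      = s * (h \<bullet> (Df (x + s *\<^sub>R k + z *\<^sub>R h) - Df (x + z *\<^sub>R h)))" by blast
    have zh: "norm (z *\<^sub>R h) \<le> s * norm h" using z by (simp add: mult_right_mono)
    have sk: "norm (s *\<^sub>R k) = s * norm k" using s by simp
    have n1: "norm (z *\<^sub>R h) \<le> s * C" using zh s by (simp add: C_def distrib_left)
       (smt (verit) mult_nonneg_nonneg norm_ge_zero)
    have n2: "norm (s *\<^sub>R k + z *\<^sub>R h) \<le> s * C"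
      using zh sk s norm_triangle_ineq[of "s *\<^sub>R k" "z *\<^sub>R h"] by (simp add: C_def distrib_left)
    define E1 E2 where "E1 = Df (x + z *\<^sub>R h) - Df x - L (z *\<^sub>R h)"
      and "E2 = Df (x + s *\<^sub>R k + z *\<^sub>R h) - Df x - L (s *\<^sub>R k + z *\<^sub>R h)"
    have "norm E1 \<le> e' * norm (z *\<^sub>R h)"
      using dD[of "x + z *\<^sub>R h"] n1 sC by (simp add: E1_def)
    also have "\<dots> \<le> e' * (s * C)" using n1 e' by (intro mult_left_mono) auto
    finally have E1: "norm E1 \<le> e' * (s * C)" .
    have "norm E2 \<le> e' * norm (s *\<^sub>R k + z *\<^sub>R h)"
      using dD[of "x + s *\<^sub>R k + z *\<^sub>R h"] n2 sC by (simp add: E2_def add.assoc)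
    also have "\<dots> \<le> e' * (s * C)" using n2 e' by (intro mult_left_mono) auto
    finally have E2: "norm E2 \<le> e' * (s * C)" .
    \<comment> \<open>The terms \<open>L (z *\<^sub>R h)\<close> cancel, so the unknown
      \<open>z\<close> survives only in the remainders.\<close>
    have dec: "Df (x + s *\<^sub>R k + z *\<^sub>R h) - Df (x + z *\<^sub>R h) = s *\<^sub>R L k + (E2 - E1)"
      by (simp add: E1_def E2_def L.add L.scaleR algebra_simps)
    have "\<bar>s * (h \<bullet> (E2 - E1))\<bar> \<le> s * (norm h * norm (E2 - E1))"
      using s Cauchy_Schwarz_ineq2[of h "E2 - E1"] by (simp add: abs_mult)
    also have "\<dots> \<le> s * (C * (2 * (e' * (s * C))))"
      using s E1 E2 C norm_triangle_ineq4[of E2 E1]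
      by (intro mult_left_mono mult_mono) (auto simp: C_def)
    also have "\<dots> = e * s\<^sup>2" using C by (simp add: e'_def power2_eq_square)
    finally have "\<bar>s * (h \<bullet> (E2 - E1))\<bar> \<le> e * s\<^sup>2" .
    then show "\<bar>f (x + s *\<^sub>R h + s *\<^sub>R k) - f (x + s *\<^sub>R h) - f (x + s *\<^sub>R k) + f x - s\<^sup>2 * (h \<bullet> L k)\<bar> \<le> e * s\<^sup>2"
      unfolding eq dec by (simp add: inner_add_right power2_eq_square algebra_simps)
  qed
qed

text \<open>The second difference is unchanged when \<open>h\<close> and \<open>k\<close> are
  swapped, yet after division by \<open>s\<^sup>2\<close> it tends to \<open>h \<bullet> L k\<close>
  in one order and to \<open>k \<bullet> L h\<close> in the other.\<close>

lemma second_derivative_symmetric: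
  fixes f :: "'a::real_inner \<Rightarrow> real"
  assumes G: "\<And>y. y \<in> ball x r \<Longrightarrow> GDERIV f y :> Df y" and r: "r > 0"
    and D: "(Df has_derivative L) (at x)"
  shows "h \<bullet> L k = k \<bullet> L h"
proof (rule ccontr)
  assume ne: "h \<bullet> L k \<noteq> k \<bullet> L h"
  \<comment> \<open>A third of the gap: two errors of size \<open>e\<close> cannot bridge
    it.\<close>
  define e where "e = \<bar>h \<bullet> L k - k \<bullet> L h\<bar> / 3"
  have e: "e > 0" using ne by (simp add: e_def)
  have bound: "\<forall>\<^sub>F s in at_right 0.
    \<bar>f (x + s *\<^sub>R h + s *\<^sub>R k) - f (x + s *\<^sub>R h) - f (x + s *\<^sub>R k) + f x - s\<^sup>2 * (h \<bullet> L k)\<bar> \<le> e * s\<^sup>2"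
    for h k by (rule second_difference_bound[OF G r D e])
  have "\<forall>\<^sub>F s::real in at_right 0. s > 0" by (simp add: eventually_at_right_less)
  with bound[of h k] bound[of k h]
  have "\<forall>\<^sub>F s::real in at_right 0. False"
  proof eventually_elim
    case (elim s)
    have *: "x + s *\<^sub>R k + s *\<^sub>R h = x + s *\<^sub>R h + s *\<^sub>R k" by simp
    have "\<bar>s\<^sup>2 * (h \<bullet> L k) - s\<^sup>2 * (k \<bullet> L h)\<bar> \<le> 2 * (e * s\<^sup>2)"
      using elim(1,2) unfolding * by linarith
    moreover have "\<bar>s\<^sup>2 * (h \<bullet> L k) - s\<^sup>2 * (k \<bullet> L h)\<bar> = s\<^sup>2 * \<bar>h \<bullet> L k - k \<bullet> L h\<bar>"
      by (simp add: right_diff_distrib[symmetric] abs_mult)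
    ultimately have "s\<^sup>2 * \<bar>h \<bullet> L k - k \<bullet> L h\<bar> \<le> s\<^sup>2 * (2 * e)"
      by (simp add: mult_ac)
    then have "\<bar>h \<bullet> L k - k \<bullet> L h\<bar> \<le> 2 * e" using elim(3) by simp
    then show ?case using ne by (simp add: e_def)
  qed
  then show False by simp
qed

text \<open>The gradient vanishes by Fermat's criterion. If \<open>h \<bullet> L h\<close> were
  positive, the directional derivative along \<open>h\<close> would be positive just after 0, and
  the mean value theorem would give a value above the maximum.\<close>

lemma second_derivative_test_max:
  fixes f :: "'a::real_inner \<Rightarrow> real"
  assumes G: "\<And>y. y \<in> ball x r \<Longrightarrow> GDERIV f y :> Df y" and r: "r > 0"
    and D: "(Df has_derivative L) (at x)"
    and max: "\<And>y. y \<in> ball x r \<Longrightarrow> f y \<le> f x"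
  shows "Df x = 0" and "h \<bullet> L h \<le> 0"
proof -
  have crit: "Df x = 0"
  proof -
    have "(\<lambda>h. h \<bullet> Df x) = (\<lambda>_. 0)"
      using G[of x] r max by (intro differential_zero_maxmin[of x "ball x r" f]) (auto simp: gderiv_def)
    then have "Df x \<bullet> Df x = 0" by meson
    then show ?thesis by simp
  qed
  then show "Df x = 0" .
  show "h \<bullet> L h \<le> 0"
  proof (rule ccontr)
    assume pos: "\<not> h \<bullet> L h \<le> 0"
    interpret L: bounded_linear L using D has_derivative_bounded_linear by blast
    define g where "g s = h \<bullet> Df (x + s *\<^sub>R h)" for s :: real
    have D': "(Df has_derivative L) (at (x + 0 *\<^sub>R h))" using D by simp
    have "((\<lambda>s. Df (x + s *\<^sub>R h)) has_derivative (\<lambda>s. L (s *\<^sub>R h))) (at 0)"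
      by (rule has_derivative_compose[of "\<lambda>s. x + s *\<^sub>R h", OF _ D'])
        (auto intro!: derivative_eq_intros)
    then have "(g has_derivative (\<lambda>s. h \<bullet> L (s *\<^sub>R h))) (at 0)"
      unfolding g_def by (rule has_derivative_inner_right)
    then have "DERIV g 0 :> h \<bullet> L h"
      by (simp add: has_field_derivative_def L.scaleR mult_commute_abs)
    then obtain d where d: "d > 0" "\<And>s. 0 < s \<Longrightarrow> s < d \<Longrightarrow> g 0 < g (0 + s)"
      using DERIV_pos_inc_right[of g] pos by (metis not_le)
    have h: "norm h > 0" using pos by auto
    define s where "s = min d (r / norm h) / 2"
    have s: "0 < s" "s < d" "s * norm h < r"
      using d r h by (auto simp: s_def min_def field_simps)
    have inb: "x + z *\<^sub>R h \<in> ball x r" if "0 \<le> z" "z \<le> s" for z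
    proof -
      have "z * norm h \<le> s * norm h" using that h by simp
      then show ?thesis using s that by (simp add: dist_norm)
    qed
    obtain z where z: "0 < z" "z < s" "f (x + s *\<^sub>R h) - f (x + 0 *\<^sub>R h) = (s - 0) * g z"
      using MVT2[OF s(1), of "\<lambda>s. f (x + s *\<^sub>R h)" g] has_real_derivative_along_line[OF G[OF inb]]
      unfolding g_def by blast
    have "g z > 0" using d(2)[of z] z s crit by (simp add: g_def)
    then have "f (x + s *\<^sub>R h) > f x" using z s by (smt (verit) add.right_neutral mult_pos_pos scale_zero_left)
    then show False using max[OF inb[of s]] s by simp
  qed
qed

section \<open>The abstract parabolic maximum principle\<close>

lemma parabolic_boundary_compact:
  fixes U :: "'a::euclidean_space set"
  assumes "open U" "bounded U"
  shows "compact (parabolic_boundary U T)"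
proof -
  \<comment> \<open>Dropping the upper end of the removed time interval changes nothing inside
    \<open>{0..T}\<close> but makes the removed set open.\<close>
  have "parabolic_boundary U T = (closure U \<times> {0..T}) - (U \<times> {0<..})"
    by (auto simp: parabolic_boundary_def)
  moreover have "compact (closure U \<times> {0..T})"
    using assms by (intro compact_Times) (auto simp: compact_closure)
  ultimately show ?thesis
    using assms by (auto intro!: compact_diff open_Times)
qed

text \<open>The perturbation \<open>- \<epsilon> t\<close> makes the time derivative positive at a maximum without
  touching the spatial derivatives.\<close>
lemma parabolic_max_principle:
  fixes u :: "'a::euclidean_space \<Rightarrow> real \<Rightarrow> real"
  assumes U: "open U" "bounded U" "U \<noteq> {}" and T: "T > 0"
    and cont: "continuous_on (closure U \<times> {0..T}) (\<lambda>(x, t). u x t)"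
    and dt: "\<And>x t. x \<in> U \<Longrightarrow> t \<in> {0<..T} \<Longrightarrow>
      ((\<lambda>s. u x s) has_vector_derivative Dt x t) (at t within {0<..T})"
    and max: "\<And>x t. x \<in> U \<Longrightarrow> t \<in> {0<..T} \<Longrightarrow> (\<And>y. y \<in> U \<Longrightarrow> u y t \<le> u x t) \<Longrightarrow> Dt x t \<le> 0"
  shows "\<exists>M. is_max_on (\<lambda>(x, t). u x t) (closure U \<times> {0..T}) M \<and>
             is_max_on (\<lambda>(x, t). u x t) (parabolic_boundary U T) M"
proof -
  let ?Q = "closure U \<times> {0..T}" and ?B = "parabolic_boundary U T"
  have cQ: "compact ?Q" using U by (intro compact_Times) (auto simp: compact_closure)
  have BQ: "?B \<subseteq> ?Q" by (auto simp: parabolic_boundary_def)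
  obtain p where "p \<in> U" using U by blast
  then have "(p, 0) \<in> ?B" using T closure_subset by (auto simp: parabolic_boundary_def)
  then have neB: "?B \<noteq> {}" by blast
  obtain zb where zb: "zb \<in> ?B" and m: "\<And>z. z \<in> ?B \<Longrightarrow> (case z of (x, t) \<Rightarrow> u x t) \<le> (case zb of (x, t) \<Rightarrow> u x t)"
    using continuous_attains_sup[OF parabolic_boundary_compact[OF U(1,2)] neB continuous_on_subset[OF cont BQ]]
    by blast
  define M where "M = (case zb of (x, t) \<Rightarrow> u x t)"
  have "u x t \<le> M" if xt: "x \<in> closure U" "t \<in> {0..T}" for x t
  proof (rule ccontr)
    assume "\<not> u x t \<le> M"
    \<comment> \<open>The perturbation costs at most \<open>\<epsilon> * T\<close>, half of the
      excess of \<open>u x t\<close> over \<open>M\<close>, so the perturbed maximum still exceeds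
      \<open>M\<close> and is not attained on the parabolic boundary.\<close>
    define \<epsilon> where "\<epsilon> = (u x t - M) / (2 * T)"
    have \<epsilon>: "\<epsilon> > 0" "u x t - \<epsilon> * T > M"
      using \<open>\<not> u x t \<le> M\<close> T by (auto simp: \<epsilon>_def field_simps)
    have "continuous_on ?Q (\<lambda>z. (case z of (x, t) \<Rightarrow> u x t) - \<epsilon> * snd z)"
      using cont by (intro continuous_intros) auto
    then obtain z0 where "z0 \<in> ?Q" and z0: "\<And>z. z \<in> ?Q \<Longrightarrow>
        (case z of (x, t) \<Rightarrow> u x t) - \<epsilon> * snd z \<le> (case z0 of (x, t) \<Rightarrow> u x t) - \<epsilon> * snd z0"
      using continuous_attains_sup[OF cQ, of "\<lambda>z. (case z of (x, t) \<Rightarrow> u x t) - \<epsilon> * snd z"] BQ neB by blast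
    obtain x0 t0 where z0eq: "z0 = (x0, t0)" by fastforce
    have Q0: "x0 \<in> closure U" "t0 \<in> {0..T}" using \<open>z0 \<in> ?Q\<close> by (auto simp: z0eq)
    have w: "u y s - \<epsilon> * s \<le> u x0 t0 - \<epsilon> * t0" if "y \<in> closure U" "s \<in> {0..T}" for y s
      using z0[of "(y, s)"] that by (simp add: z0eq)
    have "\<epsilon> * t \<le> \<epsilon> * T" "0 \<le> \<epsilon> * t0" using xt Q0 \<epsilon> by auto
    then have "u x0 t0 > M" using w[OF xt] \<epsilon> by linarith
    then have "(x0, t0) \<notin> ?B" using m[of "(x0, t0)"] by (auto simp: M_def)
    then have in0: "x0 \<in> U" "t0 \<in> {0<..T}" using Q0 by (auto simp: parabolic_boundary_def)
    have "Dt x0 t0 \<le> 0"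
    proof (rule max[OF in0])
      fix y assume "y \<in> U"
      then show "u y t0 \<le> u x0 t0" using w[of y t0] Q0 closure_subset by auto
    qed
    \<comment> \<open>The slope is negative, so slightly earlier times give larger values, against
      maximality. Only times before \<open>t0\<close> enter, which covers
      \<open>t0 = T\<close>.\<close>
    moreover have "((\<lambda>s. u x0 s - \<epsilon> * s) has_real_derivative (Dt x0 t0 - \<epsilon>)) (at t0 within {0<..T})"
      using dt[OF in0] unfolding has_real_derivative_iff_has_vector_derivative[symmetric]
      by (auto intro!: derivative_eq_intros)
    ultimately obtain d where d: "d > 0"
      "\<And>h. h > 0 \<Longrightarrow> t0 - h \<in> {0<..T} \<Longrightarrow> h < d \<Longrightarrow> u x0 t0 - \<epsilon> * t0 < u x0 (t0 - h) - \<epsilon> * (t0 - h)"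
      using has_real_derivative_neg_dec_left[of "\<lambda>s. u x0 s - \<epsilon> * s"] \<epsilon>(1)
      by (smt (verit))
    define h where "h = min d t0 / 2"
    have h: "h > 0" "h < d" "t0 - h \<in> {0<..T}" using d(1) in0 by (auto simp: h_def min_def)
    then show False using d(2)[of h] w[of x0 "t0 - h"] Q0(1) by auto
  qed
  then have "is_max_on (\<lambda>(x, t). u x t) ?Q M"
    unfolding is_max_on_def
    by (intro conjI bexI[of _ zb]) (use zb BQ in \<open>auto simp: M_def\<close>)
  moreover have "is_max_on (\<lambda>(x, t). u x t) ?B M"
    unfolding is_max_on_def
    by (intro conjI bexI[of _ zb] ballI m[folded M_def]) (use zb in \<open>auto simp: M_def\<close>)
  ultimately show ?thesis by blast
qed

section \<open>Divergence as a trace, and the cross product matrix\<close>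

lemma divergence_compose:
  fixes W X :: "real^'n \<Rightarrow> real^'n"
  assumes X: "(X has_derivative X') (at (W x))" and W: "(W has_derivative (\<lambda>h. M *v h)) (at x)"
  shows "divergence (\<lambda>y. X (W y)) x = trace (matrix X' ** M)"
proof -
  have "((\<lambda>y. X (W y)) has_derivative (\<lambda>h. X' (M *v h))) (at x)"
    using has_derivative_compose[OF W X] .
  then have "frechet_derivative (\<lambda>y. X (W y)) (at x) = (\<lambda>h. X' (M *v h))"
    using frechet_derivative_at by metis
  moreover have "X' (M *v h) = (matrix X' ** M) *v h" for h
    using has_derivative_linear[OF X] by (simp add: matrix_vector_mul_assoc[symmetric] matrix_works)
  ultimately show ?thesis
    by (simp add: divergence_def trace_def matrix_vector_mult_basis column_def)
qed

lemma grad_eq: "GDERIV f x :> D \<Longrightarrow> grad f x = D"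
  unfolding gderiv_def grad_def
  by (subst frechet_derivative_at[symmetric], assumption) (simp add: vec_eq_iff inner_axis')

text \<open>The scalar triple product is alternating. This makes the rotation term drop out of the
  monotonicity estimate and the form of \<open>J ** J\<close> nonpositive.\<close>

lemma cross_matrix_antisymmetric:
  assumes J: "\<And>x. J *v x = cross3 k x"
  shows "(J *v x) \<bullet> y = - (x \<bullet> (J *v y))"
  unfolding J by (simp add: cross3_simps inner_vec_def sum_3)

section \<open>Application to the Forchheimer equation\<close>

theorem theorem3p1:
  fixes N :: nat and \<alpha> a :: "nat \<Rightarrow> real"
    and k :: "real^3" and J :: "real^3^3"
    and R \<phi> G \<Omega> T :: real
    and e0 :: "real \<Rightarrow> real^3"
    and U :: "(real^3) set"
    and u :: "real^3 \<Rightarrow> real \<Rightarrow> real"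
  assumes "N \<ge> 1"
    and "\<alpha> 0 = 0" and "\<And>i. i < N \<Longrightarrow> \<alpha> i < \<alpha> (Suc i)"
    and "\<And>i. i \<le> N \<Longrightarrow> a i > 0"
    and "norm k = 1"
    and "\<And>x. J *v x = cross3 k x"
    and "R \<ge> 0"
    and "open U" and "bounded U" and "U \<noteq> {}" and "C1_boundary U"
    and "\<phi> > 0" and "G > 0" and "\<Omega> \<ge> 0"
    and "smooth_curve e0" and "\<And>t. norm (e0 t) = 1"
    and "T > 0"
    and "continuous_on (closure U \<times> {0..T}) (\<lambda>(x, t). u x t)"
    and "C21_on U {0<..T} u"
    and "\<And>x t. x \<in> closure U \<Longrightarrow> t \<in> {0..T} \<Longrightarrow> u x t \<ge> 0"
    and "\<And>x t. x \<in> U \<Longrightarrow> t \<in> {0<..T} \<Longrightarrow>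
           \<phi> * vector_derivative (\<lambda>s. u x s) (at t within {0<..T}) =
           divergence (\<lambda>y. forch_X N \<alpha> a R J
             (grad (\<lambda>z. u z t) y + (u y t)\<^sup>2 *\<^sub>R forch_Z G e0 \<Omega> J y t)) x"
  shows "\<exists>M. is_max_on (\<lambda>(x, t). u x t) (closure U \<times> {0..T}) M \<and>
             is_max_on (\<lambda>(x, t). u x t) (parabolic_boundary U T) M"
proof -
  note pde = assms(21)
  obtain Du D2u Dtu where
    Du: "\<And>x t. x \<in> U \<Longrightarrow> t \<in> {0<..T} \<Longrightarrow> GDERIV (\<lambda>y. u y t) x :> Du x t"
    and D2u: "\<And>x t. x \<in> U \<Longrightarrow> t \<in> {0<..T} \<Longrightarrow> ((\<lambda>y. Du y t) has_derivative (\<lambda>h. D2u x t *v h)) (at x)"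
    and Dtu: "\<And>x t. x \<in> U \<Longrightarrow> t \<in> {0<..T} \<Longrightarrow>
      ((\<lambda>s. u x s) has_vector_derivative Dtu x t) (at t within {0<..T})"
    using assms(19) unfolding C21_on_def by blast
  have \<alpha>: "\<alpha> i > 0" if "1 \<le> i" "i \<le> N" for i
    using that
  proof (induction i rule: dec_induct)
    case base
    then show ?case using assms(2) assms(3)[of 0] by simp
  next
    case (step n)
    then show ?case using assms(3)[of n] by simp
  qed
  note J = cross_matrix_antisymmetric[of J k, OF assms(6)]
  have J0: "(J *v x) \<bullet> x = 0" for x using J[of x x] by (simp add: inner_commute)
  let ?F = "forch_F N \<alpha> a R J"
  have a0: "a 0 > 0" using assms(4) by simp
  have mono: "a 0 * (norm (v - w))\<^sup>2 \<le> (?F v - ?F w) \<bullet> (v - w)" for v w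
    by (rule forch_F_strongly_monotone[OF \<alpha> assms(4) J0])
  have diff: "?F differentiable (at x)" for x
    by (rule forch_F_differentiable[OF \<alpha>])
  \<comment> \<open>This form is visibly symmetric, and nonpositive on the diagonal.\<close>
  have JJ: "((J ** J) *v x) \<bullet> y = - ((J *v x) \<bullet> (J *v y))" for x y
    using J[of "J *v x" y] by (simp add: matrix_vector_mul_assoc)
  have "Dtu x t \<le> 0"
    if x: "x \<in> U" and t: "t \<in> {0<..T}" and max: "\<And>y. y \<in> U \<Longrightarrow> u y t \<le> u x t" for x t
  proof -
    obtain r where r: "r > 0" "ball x r \<subseteq> U" using x assms(8) open_contains_ball by blast
    have Dur: "GDERIV (\<lambda>y. u y t) y :> Du y t" if "y \<in> ball x r" for y
      using Du r t that by blast
    have crit: "Du x t = 0" and hess: "h \<bullet> (D2u x t *v h) \<le> 0" for h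
      using second_derivative_test_max[of x r "\<lambda>y. u y t", OF Dur r(1) D2u[OF x t]] max r(2) by blast+
    have symm: "h \<bullet> (D2u x t *v k) = k \<bullet> (D2u x t *v h)" for h k
      using second_derivative_symmetric[of x r "\<lambda>y. u y t", OF Dur r(1) D2u[OF x t]] .
    \<comment> \<open>The Jacobian of the argument of \<open>forch_X\<close> at a spatial maximum:
      the derivative of \<open>(u y t)\<^sup>2\<close> contributes nothing there because
      \<open>Du x t = 0\<close>.\<close>
    define M where "M = D2u x t + ((u x t)\<^sup>2 * \<Omega>\<^sup>2) *\<^sub>R (J ** J)"
    have Mv: "M *v h = D2u x t *v h + ((u x t)\<^sup>2 * \<Omega>\<^sup>2) *\<^sub>R ((J ** J) *v h)" for h
      by (simp add: M_def matrix_vector_mult_add_rdistrib scaleR_matrix_vector_assoc)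
    define W where "W y = grad (\<lambda>z. u z t) y + (u y t)\<^sup>2 *\<^sub>R forch_Z G e0 \<Omega> J y t" for y
    have W: "(W has_derivative (\<lambda>h. M *v h)) (at x)"
    \<comment> \<open>\<open>grad\<close> is known to coincide with \<open>Du\<close> only on
      \<open>U\<close>, so the derivative is transferred along this open set.\<close>
    proof (rule has_derivative_transform_within_open[OF _ assms(8) x])
      have u': "((\<lambda>y. u y t) has_derivative (\<lambda>h. 0)) (at x)"
        using Du[OF x t] by (simp add: gderiv_def crit)
      have Z': "((\<lambda>y. forch_Z G e0 \<Omega> J y t) has_derivative (\<lambda>h. \<Omega>\<^sup>2 *\<^sub>R ((J ** J) *v h))) (at x)"
        unfolding forch_Z_def by (auto intro!: derivative_eq_intros bounded_linear.has_derivative[OF matrix_vector_mul_bounded_linear])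
      show "((\<lambda>y. Du y t + (u y t)\<^sup>2 *\<^sub>R forch_Z G e0 \<Omega> J y t) has_derivative (\<lambda>h. M *v h)) (at x)"
        by (rule derivative_eq_intros D2u[OF x t] u' Z' refl)+ (simp add: Mv fun_eq_iff)
      show "Du y t + (u y t)\<^sup>2 *\<^sub>R forch_Z G e0 \<Omega> J y t = W y" if "y \<in> U" for y
        using grad_eq[OF Du[OF that t]] by (simp add: W_def)
    qed
    obtain X' where X': "(inv ?F has_derivative X') (at (W x))" "\<And>h. 0 \<le> X' h \<bullet> h"
      by (rule strongly_monotone_inverse_derivative[where y = "W x", OF a0 diff mono]) blast
    have "trace (matrix X' ** M) \<le> 0"
    proof (rule trace_matrix_mult_nonpos)
      show "0 \<le> (matrix X' *v h) \<bullet> h" for h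
        using X'(2)[of h] has_derivative_linear[OF X'(1)] by (simp add: matrix_works)
      have "x \<bullet> (M *v y) = y \<bullet> (M *v x)" for x y
        using symm[of x y] JJ[of x y] JJ[of y x] by (simp add: Mv inner_add_right inner_commute)
      then have "axis i 1 \<bullet> (M *v axis j 1) = axis j 1 \<bullet> (M *v axis i 1)" for i j .
      then show "transpose M = M"
        by (simp add: vec_eq_iff transpose_def inner_axis' matrix_vector_mult_basis column_def)
      show "(M *v h) \<bullet> h \<le> 0" for h
      proof -
        have "(M *v h) \<bullet> h = h \<bullet> (D2u x t *v h) - (u x t)\<^sup>2 * \<Omega>\<^sup>2 * ((J *v h) \<bullet> (J *v h))"
          by (simp add: Mv inner_add_left JJ inner_commute[of h])
        moreover have "0 \<le> (u x t)\<^sup>2 * \<Omega>\<^sup>2 * ((J *v h) \<bullet> (J *v h))" by simp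
        ultimately show ?thesis using hess[of h] by linarith
      qed
    qed
    moreover have "\<phi> * Dtu x t = trace (matrix X' ** M)"
    proof -
      \<comment> \<open>Derivatives within \<open>{0<..T}\<close> are unique only at limit points;
        this identifies \<open>vector_derivative\<close> with \<open>Dtu\<close>, also at
        \<open>t = T\<close>.\<close>
      have "t islimpt {0<..T}"
        using t by (intro islimpt_subset[OF islimpt_greaterThanLessThan2[of 0 t]]) auto
      then have "at t within {0<..T} \<noteq> bot"
        by (simp add: trivial_limit_within)
      then have "vector_derivative (\<lambda>s. u x s) (at t within {0<..T}) = Dtu x t"
        by (rule vector_derivative_within[OF _ Dtu[OF x t]])
      then show ?thesis
        using pde[OF x t] divergence_compose[OF X'(1) W] by (simp add: forch_X_def W_def)
    qed
    ultimately have "\<phi> * Dtu x t \<le> 0" by simp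
    then show "Dtu x t \<le> 0" using assms(12) by (simp add: mult_le_0_iff)
  qed
  then show ?thesis
    using parabolic_max_principle[OF assms(8-10) assms(17,18) Dtu] by simp
qed

end
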